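(* Let $A\subset\mathbb{R}^n$ be a nonempty finite set. Then the DSONC cone of $A$ is contained in the SONC cone of $A$, i.e. $D_A\subseteq S_A$.
   Context: For a finite set $A\subset\mathbb{R}^n$, $\mathbb{R}^A$ denotes the real vector space of exponential sums $f(x)=\sum_{\alpha\in A}c_\alpha e^{\langle x,\alpha\rangle}$, $x\in\mathbb{R}^n$, with $c_\alpha\in\mathbb{R}$; it is identified with $\mathbb{R}^{\#A}$ via the coefficient vector. A (simplicial) circuit is either a single point, or a set $C=C^+\cup\{\beta\}\subset\mathbb{R}^n$ where $C^+$ is a finite affinely independent set with at least two points and $\beta$ is in the relative interior of the simplex $\mathrm{conv}(C^+)$. A circuit function supported on a circuit $C$ is an exponential sum with support $C$ whose coefficients at the vertices of $\mathrm{conv}(C)$ are positive (the coefficient at the inner point $\beta$, if there is one, may have any sign). SONC cone: $S_A\subset\mathbb{R}^A$ is the convex cone of all finite sums of circuit functions with support contained in $A$ that are nonnegative on $\mathbb{R}^n$ (including the empty sum $0$). For $A^+\subset\mathbb{R}^n$ finite and $\beta\in\mathbb{R}^n$ let $\Lambda(A^+,\beta)=\{\lambda\in\mathbb{R}_{\ge0}^{A^+}:\sum_{\alpha\in A^+}\lambda_\alpha\alpha=\beta,\ \sum_{\alpha\in A^+}\lambda_\alpha=1\}$. For $\beta\in\mathrm{conv}(A^+)\setminus A^+$ let $D_{A^+,\beta}$ be the set of all $f(x)=\sum_{\alpha\in A^+}c_\alpha e^{\langle x,\alpha\rangle}+c_\beta e^{\langle x,\beta\rangle}$ with $c_\alpha\ge0$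 for all $\alpha\in A^+$ and such that either $c_\beta\ge0$, or $|c_\beta|\le\prod_{\alpha\in A^+}c_\alpha^{\lambda_\alpha}$ for all $\lambda\in\Lambda(A^+,\beta)$ (convention $0^0=1$). DSONC cone: $D_A\subset\mathbb{R}^A$ is the convex cone generated by the exponential monomials $e^{\langle x,\alpha\rangle}$, $\alpha\in A$, together with all sets $D_{A^+,\beta}$ where $A^+\subseteq A$ and $\beta\in A\setminus A^+$ with $\beta\in\mathrm{conv}(A^+)$. *)

theory Defs
  imports "HOL-Analysis.Analysis"
begin

(* Exponential sums are treated as functions on R^n.  Since the functions
   x |-> exp (x . a), a in A, are linearly independent, this agrees with the
   coefficient-vector view of the space of exponential sums over a finite A. *)
definition exp_sum :: "(real^'n) set \<Rightarrow> (real^'n \<Rightarrow> real) \<Rightarrow> real^'n \<Rightarrow> real" where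
  "exp_sum A c = (\<lambda>x. \<Sum>\<alpha>\<in>A. c \<alpha> * exp (x \<bullet> \<alpha>))"

definition is_circuit :: "(real^'n) set \<Rightarrow> bool" where
  "is_circuit C \<longleftrightarrow>
     (\<exists>\<alpha>. C = {\<alpha>}) \<or>
     (\<exists>V \<beta>. C = V \<union> {\<beta>} \<and> finite V \<and> \<not> affine_dependent V \<and> 2 \<le> card V \<and>
            \<beta> \<in> rel_interior (convex hull V))"

(* Having support C means that every coefficient on C is nonzero; in particular the
   coefficient of an inner point may be positive or negative, but is not 0. *)
definition circuit_function :: "(real^'n) set \<Rightarrow> (real^'n \<Rightarrow> real) \<Rightarrow> bool" where
  "circuit_function C f \<longleftrightarrow>
     is_circuit C \<and>
     (\<exists>c. f = exp_sum C c \<and> (\<forall>\<alpha>\<in>C. c \<alpha> \<noteq> 0) \<and>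
          (\<forall>\<alpha>. \<alpha> extreme_point_of (convex hull C) \<longrightarrow> 0 < c \<alpha>))"

definition SONC :: "(real^'n) set \<Rightarrow> (real^'n \<Rightarrow> real) set" where
  "SONC A = {f. \<exists>(k::nat) g.
     f = (\<lambda>x. \<Sum>i<k. g i x) \<and>
     (\<forall>i<k. (\<exists>C\<subseteq>A. circuit_function C (g i)) \<and> (\<forall>x. 0 \<le> g i x))}"

definition bary_coords :: "(real^'n) set \<Rightarrow> real^'n \<Rightarrow> (real^'n \<Rightarrow> real) set" where
  "bary_coords V \<beta> =
     {l \<in> V \<rightarrow>\<^sub>E {0..}. (\<Sum>\<alpha>\<in>V. l \<alpha> *\<^sub>R \<alpha>) = \<beta> \<and> (\<Sum>\<alpha>\<in>V. l \<alpha>) = 1}"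

(* In the library 0 powr 0 = 0, whereas the convention needed here is 0^0 = 1. *)
definition rpow :: "real \<Rightarrow> real \<Rightarrow> real" where
  "rpow x a = (if a = 0 then 1 else x powr a)"

(* Only meant for finite V and \<beta> in the convex hull of V but not in V. *)
definition DSONC_gen :: "(real^'n) set \<Rightarrow> real^'n \<Rightarrow> (real^'n \<Rightarrow> real) set" where
  "DSONC_gen V \<beta> =
     {f. \<exists>c b. f = (\<lambda>x. exp_sum V c x + b * exp (x \<bullet> \<beta>)) \<and>
        (\<forall>\<alpha>\<in>V. 0 \<le> c \<alpha>) \<and>
        (0 \<le> b \<or> (\<forall>l\<in>bary_coords V \<beta>. \<bar>b\<bar> \<le> (\<Prod>\<alpha>\<in>V. rpow (c \<alpha>) (l \<alpha>))))}"

(* The library's convex_cone needs a real_vector instance, which function types lack;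
   this is its characterization convex_cone_iff with pointwise operations. *)
definition fun_convex_cone :: "('a \<Rightarrow> real) set \<Rightarrow> bool" where
  "fun_convex_cone K \<longleftrightarrow>
     (\<lambda>x. 0) \<in> K \<and>
     (\<forall>f\<in>K. \<forall>g\<in>K. (\<lambda>x. f x + g x) \<in> K) \<and>
     (\<forall>f\<in>K. \<forall>r\<ge>0. (\<lambda>x. r * f x) \<in> K)"

definition DSONC :: "(real^'n) set \<Rightarrow> (real^'n \<Rightarrow> real) set" where
  "DSONC A = fun_convex_cone hull
     ({(\<lambda>x. exp (x \<bullet> \<alpha>)) | \<alpha>. \<alpha> \<in> A} \<union>
      \<Union>{DSONC_gen V \<beta> | V \<beta>. V \<subseteq> A \<and> \<beta> \<in> A - V \<and> \<beta> \<in> convex hull V})"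

end

(* For a generator over V with inner point \<beta> and coefficient b < 0, the bound
   |b| <= prod c^l holds for every representation l of \<beta> as a convex combination of V.
   By a Caratheodory argument one may pick a representation supported, with positive weights,
   on an affinely independent W.  The terms over W together with \<beta> then form a circuit
   function, nonnegative by weighted AM-GM; the remaining terms are monomials with nonnegative
   coefficients. *)
theory Submission
  imports Defs
begin

lemma SONC_zero: "(\<lambda>x. 0) \<in> SONC A"
  unfolding SONC_def by (intro CollectI exI[of _ 0]) auto

lemma SONC_add:
  assumes "f \<in> SONC A" "g \<in> SONC A"
  shows "(\<lambda>x. f x + g x) \<in> SONC A"
proof -
  obtain k :: nat and F where F: "f = (\<lambda>x. \<Sum>i<k. F i x)"
    "\<forall>i<k. (\<exists>C\<subseteq>A. circuit_function C (F i)) \<and> (\<forall>x. 0 \<le> F i x)"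
    using assms(1) unfolding SONC_def by blast
  obtain m :: nat and G where G: "g = (\<lambda>x. \<Sum>i<m. G i x)"
    "\<forall>i<m. (\<exists>C\<subseteq>A. circuit_function C (G i)) \<and> (\<forall>x. 0 \<le> G i x)"
    using assms(2) unfolding SONC_def by blast
  \<comment> \<open>Concatenation of the two families of circuit functions.\<close>
  define H where "H i = (if i < k then F i else G (i - k))" for i
  have "(\<Sum>i<k+m. H i x) = f x + g x" for x
  proof -
    have "(\<Sum>i<k+m. H i x) = (\<Sum>i<k. H i x) + (\<Sum>i<m. H (k + i) x)"
      by (induction m) (auto simp: add.assoc)
    then show ?thesis
      by (simp add: H_def F(1) G(1))
  qed
  moreover have "(\<exists>C\<subseteq>A. circuit_function C (H i)) \<and> (\<forall>x. 0 \<le> H i x)" if "i < k + m" for i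
  proof (cases "i < k")
    case False
    with that have "i - k < m" by linarith
    with False G(2) show ?thesis by (simp add: H_def)
  qed (use F(2) in \<open>simp add: H_def\<close>)
  ultimately show ?thesis
    unfolding SONC_def by (intro CollectI exI[of _ "k+m"] exI[of _ H]) auto
qed

lemma SONC_sum:
  assumes "finite I" "\<And>i. i \<in> I \<Longrightarrow> f i \<in> SONC A"
  shows "(\<lambda>x. \<Sum>i\<in>I. f i x) \<in> SONC A"
  using assms by (induction I rule: finite_induct) (auto simp: SONC_zero SONC_add)

text \<open>A strictly positive factor preserves both the exact support and the signs at the
  vertices.\<close>

lemma circuit_function_scale:
  assumes "circuit_function C f" "0 < r"
  shows "circuit_function C (\<lambda>x. r * f x)"
proof -
  obtain c where c: "f = exp_sum C c" "\<forall>\<alpha>\<in>C. c \<alpha> \<noteq> 0"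
    "\<forall>\<alpha>. \<alpha> extreme_point_of (convex hull C) \<longrightarrow> 0 < c \<alpha>" and "is_circuit C"
    using assms(1) unfolding circuit_function_def by blast
  moreover have "(\<lambda>x. r * f x) = exp_sum C (\<lambda>\<alpha>. r * c \<alpha>)"
    by (simp add: c(1) exp_sum_def sum_distrib_left mult.assoc)
  ultimately show ?thesis
    using assms(2) unfolding circuit_function_def
    by (intro conjI exI[of _ "\<lambda>\<alpha>. r * c \<alpha>"]) auto
qed

lemma SONC_scale:
  assumes "f \<in> SONC A" "0 \<le> r"
  shows "(\<lambda>x. r * f x) \<in> SONC A"
\<comment> \<open>The factor 0 would erase the support of every summand; the empty sum takes its
  place.\<close>
proof (cases "r = 0")
  case False
  with assms(2) have "0 < r" by simp
  obtain k :: nat and F where F: "f = (\<lambda>x. \<Sum>i<k. F i x)"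
    "\<forall>i<k. (\<exists>C\<subseteq>A. circuit_function C (F i)) \<and> (\<forall>x. 0 \<le> F i x)"
    using assms(1) unfolding SONC_def by blast
  have "\<exists>C\<subseteq>A. circuit_function C (\<lambda>x. r * F i x)" if "i < k" for i
    using F(2) that circuit_function_scale[OF _ \<open>0 < r\<close>] by blast
  moreover have "0 \<le> r * F i x" if "i < k" for i x
    using F(2) that assms(2) by simp
  ultimately show ?thesis
    unfolding SONC_def F(1) sum_distrib_left
    by (intro CollectI exI[of _ k] exI[of _ "\<lambda>i x. r * F i x"] conjI refl allI impI)
qed (simp add: SONC_zero)

lemma fun_convex_cone_SONC: "fun_convex_cone (SONC A)"
  by (simp add: fun_convex_cone_def SONC_zero SONC_add SONC_scale)

lemma SONC_circuit:
  assumes "circuit_function C f" "C \<subseteq> A" "\<And>x. 0 \<le> f x"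
  shows "f \<in> SONC A"
  unfolding SONC_def
  by (intro CollectI exI[of _ 1] exI[of _ "\<lambda>_. f"]) (use assms in auto)

lemma SONC_exp:
  assumes "\<alpha> \<in> A"
  shows "(\<lambda>x. exp (x \<bullet> \<alpha>)) \<in> SONC A"
proof (rule SONC_circuit[of "{\<alpha>}"])
  show "circuit_function {\<alpha>} (\<lambda>x. exp (x \<bullet> \<alpha>))"
    unfolding circuit_function_def is_circuit_def
    by (intro conjI exI[of _ "\<lambda>_. 1"]) (auto simp: exp_sum_def)
qed (use assms in auto)

lemma SONC_monomial:
  "\<alpha> \<in> A \<Longrightarrow> 0 \<le> r \<Longrightarrow> (\<lambda>x. r * exp (x \<bullet> \<alpha>)) \<in> SONC A"
  by (rule SONC_scale[OF SONC_exp])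

text \<open>Coefficients may vanish here: such a term is the zero function, itself in the cone,
  although it is no circuit function.\<close>

lemma SONC_exp_sum_nonneg:
  assumes "finite V" "V \<subseteq> A" "\<And>\<alpha>. \<alpha> \<in> V \<Longrightarrow> 0 \<le> c \<alpha>"
  shows "exp_sum V c \<in> SONC A"
  unfolding exp_sum_def by (rule SONC_sum) (use assms in \<open>auto intro!: SONC_monomial\<close>)

text \<open>A subset \<open>W\<close> of least cardinality with \<beta> in its hull works.
  Caratheodory's theorem inside \<open>W\<close> cannot select fewer points, which forces affine
  independence, and a point of weight 0 could be deleted.\<close>

lemma convex_hull_affine_independent_subset:
  fixes V :: "'a::euclidean_space set"
  assumes "finite V" "\<beta> \<in> convex hull V"
  obtains W u where "W \<subseteq> V" "\<not> affine_dependent W" "\<And>\<alpha>. \<alpha> \<in> W \<Longrightarrow> 0 < u \<alpha>"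
    "sum u W = 1" "(\<Sum>\<alpha>\<in>W. u \<alpha> *\<^sub>R \<alpha>) = \<beta>"
proof -
  obtain W where W: "W \<subseteq> V" "\<beta> \<in> convex hull W"
    and min: "\<And>S. S \<subseteq> V \<Longrightarrow> \<beta> \<in> convex hull S \<Longrightarrow> card W \<le> card S"
    using ex_has_least_nat[of "\<lambda>S. S \<subseteq> V \<and> \<beta> \<in> convex hull S" V card] assms(2) by auto
  have fin: "finite W"
    using W(1) assms(1) by (rule finite_subset)
  obtain S u where S: "S \<subseteq> W" "int (card S) \<le> aff_dim W + 1"
    and u: "\<And>x. x \<in> S \<Longrightarrow> 0 \<le> u x" "sum u S = 1" "(\<Sum>v\<in>S. u v *\<^sub>R v) = \<beta>"
    using W(2) by (subst (asm) convex_hull_caratheodory_aff_dim) blast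
  have finS: "finite S"
    using S(1) fin by (rule finite_subset)
  have "\<beta> \<in> convex hull S"
    using u finS by (auto simp: convex_hull_finite)
  then have eq: "S = W"
    using min[of S] S(1) W(1) fin card_seteq by blast
  \<comment> \<open>With \<open>S = W\<close> the Caratheodory bound reads
    \<open>card W \<le> aff_dim W + 1\<close>; the reverse inequality always holds, and equality
    characterizes affine independence.\<close>
  have "\<not> affine_dependent W"
    using S(2) aff_dim_le_card[OF fin] fin eq by (simp add: affine_independent_iff_card)
  moreover have "0 < u \<alpha>" if "\<alpha> \<in> W" for \<alpha>
  proof (rule ccontr)
    assume "\<not> 0 < u \<alpha>"
    with u(1)[of \<alpha>] that eq have "u \<alpha> = 0" by force
    then have "sum u (W - {\<alpha>}) = 1" "(\<Sum>v\<in>W - {\<alpha>}. u v *\<^sub>R v) = \<beta>"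
      using u eq fin that by (simp_all add: sum.remove[of W \<alpha>])
    then have "\<beta> \<in> convex hull (W - {\<alpha>})"
      using u(1) eq fin by (auto simp: convex_hull_finite)
    then show False
      using min[of "W - {\<alpha>}"] W(1) card_Diff1_less[OF fin that] by force
  qed
  ultimately show ?thesis
    using that[of W u] u W(1) eq by blast
qed

text \<open>Jensen's inequality for the convex function \<open>exp\<close> at the points
  \<open>ln (y i)\<close>.\<close>

lemma weighted_am_gm:
  fixes u y :: "'a \<Rightarrow> real"
  assumes "finite W" "\<And>i. i \<in> W \<Longrightarrow> 0 \<le> u i" "sum u W = 1" "\<And>i. i \<in> W \<Longrightarrow> 0 < y i"
  shows "(\<Prod>i\<in>W. y i powr u i) \<le> (\<Sum>i\<in>W. u i * y i)"
proof -
  have "W \<noteq> {}" using assms(3) by auto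
  then have "exp (\<Sum>i\<in>W. u i *\<^sub>R ln (y i)) \<le> (\<Sum>i\<in>W. u i * exp (ln (y i)))"
    using assms by (intro convex_on_sum[OF _ _ exp_convex]) auto
  moreover have "exp (\<Sum>i\<in>W. u i *\<^sub>R ln (y i)) = (\<Prod>i\<in>W. y i powr u i)"
    unfolding exp_sum[OF assms(1)]
    by (intro prod.cong) (use assms(4) in \<open>force simp: powr_def\<close>)+
  moreover have "(\<Sum>i\<in>W. u i * exp (ln (y i))) = (\<Sum>i\<in>W. u i * y i)"
    by (intro sum.cong) (use assms(4) in auto)
  ultimately show ?thesis by simp
qed

text \<open>For positive weights AM-GM would even allow the circuit number, the product of
  \<open>(c \<alpha> / u \<alpha>) powr u \<alpha>\<close>. The smaller constant without the
  denominators is the one bounding \<open>b\<close> in \<open>DSONC_gen\<close>.\<close>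

lemma exp_sum_ge_geometric_mean:
  fixes W :: "(real^'n) set"
  assumes "finite W" "\<And>\<alpha>. \<alpha> \<in> W \<Longrightarrow> 0 \<le> u \<alpha>" "sum u W = 1"
    and "(\<Sum>\<alpha>\<in>W. u \<alpha> *\<^sub>R \<alpha>) = \<beta>" "\<And>\<alpha>. \<alpha> \<in> W \<Longrightarrow> 0 < c \<alpha>"
  shows "(\<Prod>\<alpha>\<in>W. c \<alpha> powr u \<alpha>) * exp (x \<bullet> \<beta>) \<le> exp_sum W c x"
proof -
  \<comment> \<open>As \<beta> is the \<open>u\<close>-weighted mean of \<open>W\<close>, its
    exponential is the weighted geometric mean of those of \<open>W\<close>.\<close>
  have "exp (x \<bullet> \<beta>) = (\<Prod>\<alpha>\<in>W. exp (x \<bullet> \<alpha>) powr u \<alpha>)"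
    by (simp add: assms(4)[symmetric] inner_sum_right powr_def flip: exp_sum[OF assms(1)])
  then have "(\<Prod>\<alpha>\<in>W. c \<alpha> powr u \<alpha>) * exp (x \<bullet> \<beta>)
      = (\<Prod>\<alpha>\<in>W. (c \<alpha> * exp (x \<bullet> \<alpha>)) powr u \<alpha>)"
    using assms(5) by (simp add: less_imp_le powr_mult flip: prod.distrib)
  also have "\<dots> \<le> (\<Sum>\<alpha>\<in>W. u \<alpha> * (c \<alpha> * exp (x \<bullet> \<alpha>)))"
    by (rule weighted_am_gm) (use assms in auto)
  \<comment> \<open>Nonnegative weights with sum 1 are at most 1; this is where the circuit number
    is given away.\<close>
  also have "\<dots> \<le> (\<Sum>\<alpha>\<in>W. 1 * (c \<alpha> * exp (x \<bullet> \<alpha>)))"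
  proof (intro sum_mono mult_right_mono)
    fix \<alpha> assume "\<alpha> \<in> W"
    then show "u \<alpha> \<le> 1" "0 \<le> c \<alpha> * exp (x \<bullet> \<alpha>)"
      using member_le_sum[of \<alpha> W u] assms by (auto simp: less_imp_le)
  qed
  finally show ?thesis by (simp add: exp_sum_def)
qed

lemma DSONC_gen_subset_SONC:
  fixes A :: "(real^'n) set"
  assumes "finite V" "V \<subseteq> A" "\<beta> \<in> A - V" "\<beta> \<in> convex hull V"
  shows "DSONC_gen V \<beta> \<subseteq> SONC A"
proof
  fix f assume "f \<in> DSONC_gen V \<beta>"
  then obtain c b where f: "f = (\<lambda>x. exp_sum V c x + b * exp (x \<bullet> \<beta>))"
    and c: "\<And>\<alpha>. \<alpha> \<in> V \<Longrightarrow> 0 \<le> c \<alpha>"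
    and b: "0 \<le> b \<or> (\<forall>l\<in>bary_coords V \<beta>. \<bar>b\<bar> \<le> (\<Prod>\<alpha>\<in>V. rpow (c \<alpha>) (l \<alpha>)))"
    unfolding DSONC_gen_def by blast
  show "f \<in> SONC A"
  proof (cases "0 \<le> b")
    case True
    then show ?thesis
      unfolding f using assms c by (intro SONC_add SONC_exp_sum_nonneg SONC_monomial) auto
  next
    case False
    obtain W u where W: "W \<subseteq> V" "\<not> affine_dependent W"
      and u: "\<And>\<alpha>. \<alpha> \<in> W \<Longrightarrow> 0 < u \<alpha>" "sum u W = 1" "(\<Sum>\<alpha>\<in>W. u \<alpha> *\<^sub>R \<alpha>) = \<beta>"
      using convex_hull_affine_independent_subset[OF assms(1,4)] by metis
    have finW: "finite W"
      using W(1) assms(1) by (rule finite_subset)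
    have \<beta>W: "\<beta> \<notin> W"
      using W(1) assms(3) by blast
    \<comment> \<open>Extension of \<open>u\<close> by 0 to \<open>V\<close>, so that the hypothesis
      on \<open>b\<close> applies; the restriction to \<open>V\<close> meets the extensionality in
      \<open>bary_coords\<close>.\<close>
    define l where "l = (\<lambda>\<alpha>\<in>V. if \<alpha> \<in> W then u \<alpha> else 0)"
    have restr: "V \<inter> W = W" using W(1) by blast
    have "l \<in> V \<rightarrow>\<^sub>E {0..}"
      using u(1) by (auto simp: l_def less_imp_le)
    moreover have "sum l V = 1"
      using u(2) assms(1) by (simp add: l_def sum.If_cases restr)
    moreover have "(\<Sum>\<alpha>\<in>V. l \<alpha> *\<^sub>R \<alpha>) = (\<Sum>\<alpha>\<in>W. l \<alpha> *\<^sub>R \<alpha>)"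
      by (rule sum.mono_neutral_right) (use assms(1) W(1) in \<open>auto simp: l_def\<close>)
    moreover have "\<dots> = \<beta>"
      unfolding u(3)[symmetric] by (rule sum.cong) (use W(1) in \<open>auto simp: l_def\<close>)
    ultimately have "l \<in> bary_coords V \<beta>"
      by (simp add: bary_coords_def)
    with b False have "\<bar>b\<bar> \<le> (\<Prod>\<alpha>\<in>V. rpow (c \<alpha>) (l \<alpha>))" by blast
    \<comment> \<open>Outside \<open>W\<close> the exponent is 0, so by the convention in
      \<open>rpow\<close> the factor is 1 even where \<open>c\<close> vanishes.\<close>
    also have "\<dots> = (\<Prod>\<alpha>\<in>W. rpow (c \<alpha>) (l \<alpha>))"
      by (rule prod.mono_neutral_right) (use assms(1) W(1) in \<open>auto simp: l_def rpow_def\<close>)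
    also have "\<dots> = (\<Prod>\<alpha>\<in>W. c \<alpha> powr u \<alpha>)"
      by (rule prod.cong) (use W(1) u(1) in \<open>force simp: l_def rpow_def\<close>)+
    finally have ble: "\<bar>b\<bar> \<le> (\<Prod>\<alpha>\<in>W. c \<alpha> powr u \<alpha>)" .
    \<comment> \<open>Since \<open>b\<close> is negative, the product is at least
      \<open>\<bar>b\<bar> > 0\<close>, and none of its factors can vanish.\<close>
    have cpos: "0 < c \<alpha>" if "\<alpha> \<in> W" for \<alpha>
    proof -
      have "(\<Prod>\<alpha>\<in>W. c \<alpha> powr u \<alpha>) \<noteq> 0"
        using ble False by linarith
      then have "c \<alpha> \<noteq> 0"
        using that finW by auto
      with c[of \<alpha>] that W(1) show ?thesis by force
    qed
    define d where "d = c(\<beta> := b)"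
    have dsum: "exp_sum (W \<union> {\<beta>}) d x = exp_sum W c x + b * exp (x \<bullet> \<beta>)" for x
    proof -
      have "exp_sum W d x = exp_sum W c x"
        unfolding exp_sum_def by (rule sum.cong) (use \<beta>W in \<open>auto simp: d_def\<close>)
      then show ?thesis
        using finW \<beta>W by (simp add: exp_sum_def d_def)
    qed
    \<comment> \<open>The relative interior of a simplex consists of the points with all barycentric
      coordinates positive.\<close>
    have hullW: "\<beta> \<in> rel_interior (convex hull W)"
      using u W(2) by (auto simp: rel_interior_convex_hull_explicit)
    \<comment> \<open>If \<open>W\<close> were a single point, that point would be \<beta>, which is
      not in \<open>W\<close>.\<close>
    have "2 \<le> card W"
    proof (rule ccontr)
      assume "\<not> 2 \<le> card W"
      moreover have "W \<noteq> {}" using u(2) by auto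
      ultimately have "card W = 1"
        using finW card_gt_0_iff[of W] by linarith
      then obtain \<alpha> where "W = {\<alpha>}" by (rule card_1_singletonE)
      with u(2,3) \<beta>W show False by simp
    qed
    with W finW hullW have "is_circuit (W \<union> {\<beta>})"
      unfolding is_circuit_def by blast
    \<comment> \<open>Adding \<beta> does not enlarge the hull, so its extreme points lie in
      \<open>W\<close>, where \<open>d\<close> agrees with \<open>c\<close>.\<close>
    moreover have "0 < d \<alpha>" if "\<alpha> extreme_point_of (convex hull (W \<union> {\<beta>}))" for \<alpha>
    proof -
      have "\<beta> \<in> convex hull W"
        using hullW rel_interior_subset by blast
      then have "convex hull (W \<union> {\<beta>}) = convex hull W"
        by (simp add: hull_redundant)
      with that have "\<alpha> \<in> W" by (auto dest: extreme_point_of_convex_hull)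
      with cpos \<beta>W show ?thesis by (auto simp: d_def)
    qed
    moreover have "\<forall>\<alpha>\<in>W \<union> {\<beta>}. d \<alpha> \<noteq> 0"
      using cpos[THEN less_imp_neq] \<beta>W False by (auto simp: d_def)
    ultimately have "circuit_function (W \<union> {\<beta>}) (exp_sum (W \<union> {\<beta>}) d)"
      unfolding circuit_function_def by blast
    moreover have "0 \<le> exp_sum (W \<union> {\<beta>}) d x" for x
    proof -
      have "- b * exp (x \<bullet> \<beta>) \<le> (\<Prod>\<alpha>\<in>W. c \<alpha> powr u \<alpha>) * exp (x \<bullet> \<beta>)"
        by (rule mult_right_mono) (use ble in auto)
      also have "\<dots> \<le> exp_sum W c x"
        by (rule exp_sum_ge_geometric_mean) (use u cpos finW in \<open>auto simp: less_imp_le\<close>)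
      finally show ?thesis unfolding dsum by simp
    qed
    ultimately have "exp_sum (W \<union> {\<beta>}) d \<in> SONC A"
      using assms W(1) by (intro SONC_circuit[of "W \<union> {\<beta>}"]) auto
    \<comment> \<open>The terms that the circuit does not use are nonnegative multiples of
      monomials.\<close>
    moreover have "exp_sum (V - W) c \<in> SONC A"
      using assms c by (intro SONC_exp_sum_nonneg) auto
    ultimately have "(\<lambda>x. exp_sum (W \<union> {\<beta>}) d x + exp_sum (V - W) c x) \<in> SONC A"
      by (rule SONC_add)
    moreover have "f = (\<lambda>x. exp_sum (W \<union> {\<beta>}) d x + exp_sum (V - W) c x)"
      unfolding f dsum
      by (simp add: exp_sum_def sum.subset_diff[OF W(1) assms(1)] add_ac)
    ultimately show ?thesis by simp
  qed
qed

theorem corollary3p3: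
  fixes A :: "(real^'n) set"
  assumes "finite A" and "A \<noteq> {}"
  shows "DSONC A \<subseteq> SONC A"
  unfolding DSONC_def
\<comment> \<open>\<open>SONC A\<close> is itself a convex cone, so it suffices that it contains the
  generators.\<close>
proof (rule hull_minimal)
  have "DSONC_gen V \<beta> \<subseteq> SONC A" if "V \<subseteq> A" "\<beta> \<in> A - V" "\<beta> \<in> convex hull V" for V \<beta>
    using DSONC_gen_subset_SONC that finite_subset[OF _ assms(1)] by blast
  then show "{(\<lambda>x. exp (x \<bullet> \<alpha>)) | \<alpha>. \<alpha> \<in> A} \<union>
      \<Union>{DSONC_gen V \<beta> | V \<beta>. V \<subseteq> A \<and> \<beta> \<in> A - V \<and> \<beta> \<in> convex hull V} \<subseteq> SONC A"
    using SONC_exp by blast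
qed (rule fun_convex_cone_SONC)

end
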